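(* For $n\geq 1$, the total number of inversions across all parking functions of length $n$ is \[\sum_{\alpha\in \mathrm{PF}_n}\mathrm{inv}(\alpha)=\frac{n(n+1)^{n-2}}{2}\binom{n}{2}.\]
   Context: Parking functions: $n$ cars enter a one-way street with spots $1,\dots,n$ in order; car $i$ has preferred spot $\alpha_i\in[n]$ and parks in spot $\alpha_i$ if free, otherwise in the next free spot after $\alpha_i$, if any. $\mathrm{PF}_n$ is the set of lists $\alpha=(\alpha_1,\dots,\alpha_n)\in[n]^n$ for which all cars park. $\mathrm{inv}(\alpha)$ is the number of pairs $1\le i<j\le n$ with $\alpha_i>\alpha_j$. *)

theory Defs
  imports Complex_Main
begin

text \<open>Cars are processed in list order on a street with spots \<open>{1..n}\<close>; \<open>occ\<close> is the set of
  spots already taken. A car preferring spot \<open>a\<close> takes the first free spot in \<open>{a..n}\<close>, and the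
  predicate fails as soon as some car finds none.\<close>

fun all_park :: "nat \<Rightarrow> nat set \<Rightarrow> nat list \<Rightarrow> bool" where
  "all_park n occ [] = True"
| "all_park n occ (a # as) =
     ({a..n} - occ \<noteq> {} \<and> all_park n (insert (Min ({a..n} - occ)) occ) as)"

definition PF :: "nat \<Rightarrow> nat list set" where
  "PF n = {\<alpha>. length \<alpha> = n \<and> set \<alpha> \<subseteq> {1..n} \<and> all_park n {} \<alpha>}"

definition inversions :: "nat list \<Rightarrow> nat" where
  "inversions \<alpha> = card {(i, j). i < j \<and> j < length \<alpha> \<and> \<alpha> ! i > \<alpha> ! j}"

text \<open>Finiteness of the two sets, so that neither \<open>sum\<close> over \<open>PF n\<close> nor \<open>card\<close> in
  \<open>inversions\<close> takes its default value.\<close>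

lemma finite_PF: "finite (PF n)"
proof (rule finite_subset)
  show "PF n \<subseteq> {\<alpha>. set \<alpha> \<subseteq> {1..n} \<and> length \<alpha> = n}"
    by (auto simp: PF_def)
  show "finite {\<alpha>. set \<alpha> \<subseteq> {1..n} \<and> length \<alpha> = n}"
    by (rule finite_lists_length_eq) simp
qed

lemma finite_inversion_pairs:
  "finite {(i, j). i < j \<and> j < length \<alpha> \<and> \<alpha> ! i > \<alpha> ! j}"
  by (rule finite_subset [of _ "{..<length \<alpha>} \<times> {..<length \<alpha>}"]) auto

end

theory Submission
  imports Defs "HOL-Library.FuncSet" "HOL-Library.Multiset"
begin

text \<open>
  Parking is insensitive to the order of the cars: a list parks exactly when, for every \<open>k\<close>,
  no more cars prefer a spot in \<open>{k..n}\<close> than there are such spots (\<open>all_park_iff\<close>). Hence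
  swapping two entries preserves \<open>PF n\<close>, and for positions \<open>i < j\<close> the parking functions with
  \<open>\<alpha> ! i > \<alpha> ! j\<close> are as many as those with \<open>\<alpha> ! i < \<alpha> ! j\<close>. It is therefore enough to count all
  parking functions and those with \<open>\<alpha> ! i = \<alpha> ! j\<close>.

  Both counts come from Pollak's circle argument. Read preferences as residues modulo \<open>n + 1\<close>,
  residue \<open>0\<close> standing for an additional spot \<open>n + 1\<close> that closes the street to a circle. Adding
  a constant to all preferences rotates the circle, and exactly one of the \<open>n + 1\<close> rotations of
  any word of length \<open>n\<close> leaves the additional spot empty, that is, is a parking function
  (\<open>unique_parking_rotation\<close>). So a rotation-invariant property holds for \<open>n + 1\<close> times as many
  words as parking functions (\<open>card_PF_rotation_invariant\<close>). The trivial property gives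
  \<open>card (PF n) = (n + 1)^(n - 1)\<close>, and equality of two given entries gives \<open>(n + 1)^(n - 2)\<close>.
  Half of the difference, \<open>n * (n + 1)^(n - 2) / 2\<close>, is the number of parking functions inverted at
  \<open>(i, j)\<close>, and there are \<open>n choose 2\<close> such pairs.
\<close>

section \<open>Parking as a counting condition\<close>

text \<open>
  A car that prefers \<open>a\<close> and parks in \<open>m\<close> finds all of \<open>{a..<m}\<close> occupied, so \<open>{k..n}\<close> contains the
  same free spots for every \<open>k\<close> in \<open>{a..m}\<close>. For \<open>k\<close> in \<open>{a<..m}\<close> the car takes a spot of \<open>{k..n}\<close>
  without being among the cars that prefer one; there the condition at \<open>a\<close>, which does count this
  car, gives the strict inequality that leaves room for it.
\<close>

lemma all_park_iff:
  "all_park n occ \<alpha> \<longleftrightarrow> (\<forall>k. length (filter (\<lambda>x. k \<le> x) \<alpha>) \<le> card ({k..n} - occ))"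
proof (induction \<alpha> arbitrary: occ)
  case Nil
  then show ?case by simp
next
  case (Cons a \<alpha>)
  let ?free = "\<lambda>k. {k..n} - occ"
  let ?d = "\<lambda>k \<alpha>. length (filter (\<lambda>x. k \<le> x) \<alpha>)"
  show ?case
  proof (cases "?free a = {}")
    case True
    have "?d a (a # \<alpha>) > card (?free a)"
      by (simp add: True)
    then show ?thesis
      using True by (metis all_park.simps(2) not_le)
  next
    case False
    define m where "m = Min (?free a)"
    have m: "m \<in> ?free a"
      unfolding m_def by (rule Min_in) (use False in auto)
    have m_least: "m \<le> s" if "s \<in> ?free a" for s
      unfolding m_def by (rule Min_le) (use that in auto)
    define f where "f k = card (?free k)" for k
    define f' where "f' k = card ({k..n} - insert m occ)" for k
    have card_free: "f k = f' k + (if k \<le> m then 1 else 0)" for k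
    proof (cases "k \<le> m")
      case True
      then have "?free k = insert m ({k..n} - insert m occ)"
        using m by auto
      then have "card (?free k) = Suc (card ({k..n} - insert m occ))"
        by (metis Diff_iff card_insert_disjoint finite_Diff finite_atLeastAtMost insertI1)
      then show ?thesis using True by (simp add: f_def f'_def)
    next
      case False
      then have "?free k = {k..n} - insert m occ" by auto
      then show ?thesis using False by (simp add: f_def f'_def)
    qed
    have "a \<le> m" using m by simp
    have "(\<forall>k. ?d k (a # \<alpha>) \<le> f k) \<longleftrightarrow> (\<forall>k. ?d k \<alpha> \<le> f' k)"
    proof (intro iffI allI)
      fix k
      assume H: "\<forall>k. ?d k \<alpha> \<le> f' k"
      show "?d k (a # \<alpha>) \<le> f k"
        using spec[OF H, of k] \<open>a \<le> m\<close> card_free[of k] by (auto split: if_splits)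
    next
      fix k
      assume H: "\<forall>k. ?d k (a # \<alpha>) \<le> f k"
      consider "k \<le> a" | "a < k" "k \<le> m" | "m < k" by linarith
      then show "?d k \<alpha> \<le> f' k"
      proof cases
        case 1
        then show ?thesis using spec[OF H, of k] \<open>a \<le> m\<close> card_free[of k] by (auto split: if_splits)
      next
        case 2
        have "?free k = ?free a"
          using 2 m_least by force
        then have "f k = f a" by (simp add: f_def)
        moreover have "?d k \<alpha> \<le> ?d a \<alpha>"
          using 2 by (induction \<alpha>) auto
        ultimately show ?thesis
          using spec[OF H, of a] card_free[of k] 2 by simp
      next
        case 3
        then show ?thesis using spec[OF H, of k] \<open>a \<le> m\<close> card_free[of k] by (auto split: if_splits)
      qed
    qed
    then show ?thesis
      using False Cons.IH[of "insert m occ"] by (simp add: m_def f_def f'_def del: filter.simps)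
  qed
qed

text \<open>Here an entry \<open>0\<close> is the residue of the additional spot \<open>n + 1\<close>.\<close>

definition words :: "nat \<Rightarrow> nat list set" where
  "words n = {xs. length xs = n \<and> set xs \<subseteq> {..n}}"

lemma PF_subset_words: "PF n \<subseteq> words n"
  by (auto simp: PF_def words_def)

lemma finite_words: "finite (words n)"
  using finite_lists_length_eq[of "{..n}" n] by (simp add: words_def conj_commute)

lemma card_words: "card (words n) = (n + 1) ^ n"
  using card_lists_length_eq[of "{..n}" n] by (simp add: words_def conj_commute)

lemma length_filter_ge_add_counts:
  "0 \<notin> set xs \<Longrightarrow> length (filter (\<lambda>x. Suc k \<le> x) xs) + (\<Sum>v<k. count_list xs (Suc v)) = length xs"
proof (induction k)
  case 0
  then have "filter (\<lambda>x. Suc 0 \<le> x) xs = xs"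
    by (metis filter_True not_less_eq_eq le_zero_eq)
  then show ?case by simp
next
  case (Suc k)
  have "length (filter (\<lambda>x. Suc k \<le> x) xs) 
      = length (filter (\<lambda>x. Suc (Suc k) \<le> x) xs) + count_list xs (Suc k)"
    by (induction xs) auto
  then show ?case using Suc by simp
qed

lemma sum_count_list_less:
  fixes xs :: "nat list"
  shows "(\<Sum>v<k. count_list xs v) = length (filter (\<lambda>x. x < k) xs)"
proof (induction xs)
  case Nil
  then show ?case by simp
next
  case (Cons x xs)
  have "(\<Sum>v<k. count_list (x # xs) v) = (\<Sum>v<k. count_list xs v + (if v = x then 1 else 0))"
    by (rule sum.cong) auto
  also have "\<dots> = (\<Sum>v<k. count_list xs v) + (if x < k then 1 else 0)"
    by (simp add: sum.distrib)
  finally show ?case using Cons by simp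
qed

text \<open>
  Complementing the condition of \<open>all_park_iff\<close> turns it into lower bounds for prefix sums of the
  occurrence counts. The bound at \<open>k = n\<close> says that all \<open>n\<close> entries are positive, so it is the one
  that excludes the additional spot.
\<close>

lemma PF_iff_counts:
  assumes "xs \<in> words n"
  shows "xs \<in> PF n \<longleftrightarrow> (\<forall>k\<le>n. k \<le> (\<Sum>v<k. count_list xs (Suc v)))"
proof -
  have len: "length xs = n" and le_n: "set xs \<subseteq> {..n}"
    using assms by (auto simp: words_def)
  show ?thesis
  proof
    assume xs: "xs \<in> PF n"
    then have pos: "0 \<notin> set xs" by (auto simp: PF_def)
    show "\<forall>k\<le>n. k \<le> (\<Sum>v<k. count_list xs (Suc v))"
    proof (intro allI impI)
      fix k assume "k \<le> n"
      have "length (filter (\<lambda>x. Suc k \<le> x) xs) \<le> card ({Suc k..n} - {})"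
        using xs all_park_iff[of n "{}" xs] unfolding PF_def by blast
      then show "k \<le> (\<Sum>v<k. count_list xs (Suc v))"
        using length_filter_ge_add_counts[OF pos, of k] len \<open>k \<le> n\<close> by simp
    qed
  next
    assume H: "\<forall>k\<le>n. k \<le> (\<Sum>v<k. count_list xs (Suc v))"
    have "count_list xs 0 + (\<Sum>v<n. count_list xs (Suc v)) = (\<Sum>v<Suc n. count_list xs v)"
      by (simp only: sum.lessThan_Suc_shift)
    also have "\<dots> \<le> n"
      using len length_filter_le[of "\<lambda>x. x < Suc n" xs]
      by (simp add: sum_count_list_less del: sum.lessThan_Suc)
    finally have "count_list xs 0 = 0"
      using H[rule_format, of n] by simp
    then have pos: "0 \<notin> set xs" by (simp add: count_list_0_iff)
    have "length (filter (\<lambda>x. k \<le> x) xs) \<le> card ({k..n} - {})" for k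
    proof (cases k)
      case 0
      then show ?thesis using len by simp
    next
      case (Suc l)
      show ?thesis
      proof (cases "l \<le> n")
        case True
        then show ?thesis
          using length_filter_ge_add_counts[OF pos, of l] H len Suc by fastforce
      next
        case False
        then have "filter (\<lambda>x. k \<le> x) xs = []"
          using le_n Suc by (auto simp: filter_empty_conv)
        then show ?thesis by simp
      qed
    qed
    then have "all_park n {} xs" by (subst all_park_iff) auto
    moreover have "set xs \<subseteq> {1..n}"
    proof
      fix x assume "x \<in> set xs"
      moreover from this have "x \<noteq> 0" using pos by metis
      ultimately show "x \<in> {1..n}" using le_n by auto
    qed
    ultimately show "xs \<in> PF n" using len by (simp add: PF_def)
  qed
qed

section \<open>Exactly one rotation parks\<close>

text \<open>
  A sequence that loses \<open>1\<close> per period has a unique starting point in the first period from which it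
  stays at or above its initial value for a whole period: the first position of the minimum. A later
  position \<open>t\<close> cannot do so together with an earlier \<open>s\<close>, because \<open>s + N\<close> lies in the window of \<open>t\<close>,
  so that \<open>S s \<le> S t \<le> S (s + N) = S s - 1\<close>.
\<close>

lemma cycle_lemma:
  fixes S :: "nat \<Rightarrow> int"
  assumes "N > 0" and drop: "\<And>m. S (m + N) = S m - 1"
  shows "\<exists>!r. r < N \<and> (\<forall>k<N. S r \<le> S (r + k))"
proof -
  define mu where "mu = Min (S ` {..<N})"
  have mu_le: "mu \<le> S m" if "m < N" for m
    unfolding mu_def using that by (intro Min_le) auto
  have "mu \<in> S ` {..<N}"
    unfolding mu_def using \<open>N > 0\<close> by (intro Min_in) auto
  then have ex: "\<exists>r. r < N \<and> S r = mu" by auto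
  define r where "r = (LEAST r. r < N \<and> S r = mu)"
  have r: "r < N" "S r = mu"
    using LeastI_ex[OF ex] by (auto simp: r_def)
  have before_r: "mu < S m" if "m < r" for m
  proof -
    have "S m \<noteq> mu"
      using not_less_Least[of m "\<lambda>r. r < N \<and> S r = mu"] that r by (auto simp: r_def)
    then show ?thesis using mu_le[of m] that r by simp
  qed
  have good: "S r \<le> S (r + k)" if "k < N" for k
  proof (cases "r + k < N")
    case True
    then show ?thesis using mu_le r by simp
  next
    case False
    then have "S (r + k) = S (r + k - N) - 1" using drop[of "r + k - N"] by simp
    moreover have "r + k - N < r" using that False by simp
    ultimately show ?thesis using before_r[of "r + k - N"] r by simp
  qed
  have uniq: False
    if "s < t" "t < N" and s: "\<forall>k<N. S s \<le> S (s + k)" and t: "\<forall>k<N. S t \<le> S (t + k)" for s t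
  proof -
    have "S s \<le> S t" using s[rule_format, of "t - s"] that by simp
    moreover have "S t \<le> S (s + N)" using t[rule_format, of "s + N - t"] that by simp
    ultimately show False using drop[of s] by simp
  qed
  show ?thesis
  proof (rule ex1I[of _ r])
    show "r < N \<and> (\<forall>k<N. S r \<le> S (r + k))" using r good by simp
  next
    fix s assume s: "s < N \<and> (\<forall>k<N. S s \<le> S (s + k))"
    then show "s = r"
      using uniq[of s r] uniq[of r s] good r by (meson nat_neq_iff)
  qed
qed

text \<open>
  Subtraction of \<open>r\<close> modulo \<open>n + 1\<close>, written with \<open>Suc n - r\<close> to avoid truncation; it is meant
  for \<open>r \<le> n\<close>.
\<close>

definition rotate_back :: "nat \<Rightarrow> nat \<Rightarrow> nat list \<Rightarrow> nat list" where
  "rotate_back n r xs = map (\<lambda>x. (x + (Suc n - r)) mod Suc n) xs"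

definition rotate_forth :: "nat \<Rightarrow> nat \<Rightarrow> nat list \<Rightarrow> nat list" where
  "rotate_forth n r xs = map (\<lambda>x. (x + r) mod Suc n) xs"

lemma rotate_in_words:
  assumes "xs \<in> words n"
  shows "rotate_back n r xs \<in> words n" "rotate_forth n r xs \<in> words n"
  using assms by (auto simp: words_def rotate_back_def rotate_forth_def less_Suc_eq_le[symmetric])

lemma rotate_inverse:
  assumes "xs \<in> words n" "r \<le> n"
  shows "rotate_forth n r (rotate_back n r xs) = xs" "rotate_back n r (rotate_forth n r xs) = xs"
proof -
  have "((x + (Suc n - r)) mod Suc n + r) mod Suc n = x"
       "((x + r) mod Suc n + (Suc n - r)) mod Suc n = x" if "x \<in> set xs" for x
  proof -
    have "x \<le> n" using that assms by (auto simp: words_def)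
    have "((x + (Suc n - r)) mod Suc n + r) mod Suc n = (x + (Suc n - r) + r) mod Suc n"
      by (rule mod_add_left_eq)
    also have "x + (Suc n - r) + r = x + Suc n" using \<open>r \<le> n\<close> by simp
    also have "\<dots> mod Suc n = x" using \<open>x \<le> n\<close> by (simp del: add_Suc_right)
    finally show "((x + (Suc n - r)) mod Suc n + r) mod Suc n = x" .
    have "((x + r) mod Suc n + (Suc n - r)) mod Suc n = (x + r + (Suc n - r)) mod Suc n"
      by (rule mod_add_left_eq)
    also have "x + r + (Suc n - r) = x + Suc n" using \<open>r \<le> n\<close> by simp
    also have "\<dots> mod Suc n = x" using \<open>x \<le> n\<close> by (simp del: add_Suc_right)
    finally show "((x + r) mod Suc n + (Suc n - r)) mod Suc n = x" .
  qed
  then show "rotate_forth n r (rotate_back n r xs) = xs" "rotate_back n r (rotate_forth n r xs) = xs"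
    by (auto simp: rotate_back_def rotate_forth_def intro!: map_idI)
qed

lemma count_rotate_back:
  assumes "xs \<in> words n" "r \<le> n" "v \<le> n"
  shows "count_list (rotate_back n r xs) v = count_list xs ((r + v) mod Suc n)"
proof -
  have eq: "(x + (Suc n - r)) mod Suc n = v \<longleftrightarrow> x = (r + v) mod Suc n" if "x \<le> n" for x
  proof
    assume "(x + (Suc n - r)) mod Suc n = v"
    then have "(r + v) mod Suc n = (r + (x + (Suc n - r))) mod Suc n"
      by (metis mod_add_right_eq)
    also have "r + (x + (Suc n - r)) = x + Suc n" using assms by simp
    also have "\<dots> mod Suc n = x" using that by (simp del: add_Suc_right)
    finally show "x = (r + v) mod Suc n" ..
  next
    assume "x = (r + v) mod Suc n"
    then have "(x + (Suc n - r)) mod Suc n = (r + v + (Suc n - r)) mod Suc n"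
      by (metis mod_add_left_eq)
    also have "r + v + (Suc n - r) = v + Suc n" using assms by simp
    also have "\<dots> mod Suc n = v" using assms by (simp del: add_Suc_right)
    finally show "(x + (Suc n - r)) mod Suc n = v" .
  qed
  have "set xs \<subseteq> {..n}" using assms by (simp add: words_def)
  then show ?thesis
    by (induction xs) (auto simp: rotate_back_def eq)
qed

text \<open>
  Rotating a word by \<open>r\<close> moves the start of the prefix sums in \<open>PF_iff_counts\<close> to position \<open>r\<close> of
  the periodic sequence of counts. The count minus one, summed over a period of \<open>n + 1\<close> residues, is
  \<open>n - (n + 1) = - 1\<close>, so the cycle lemma applies.
\<close>

lemma unique_parking_rotation:
  assumes xs: "xs \<in> words n"
  shows "\<exists>!r. r \<le> n \<and> rotate_back n r xs \<in> PF n"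
proof -
  define c where "c v = count_list xs (v mod Suc n)" for v
  define T where "T m = (\<Sum>v<m. c (Suc v))" for m
  define S where "S m = int (T m) - int m" for m
  have period: "T (m + Suc n) = T m + n" for m
  proof (induction m)
    case 0
    have "T (Suc n) = (\<Sum>v<n. c (Suc v)) + c 0"
      by (simp add: T_def c_def)
    also have "\<dots> = (\<Sum>v<Suc n. c v)"
      by (simp only: sum.lessThan_Suc_shift add.commute)
    also have "\<dots> = (\<Sum>v<Suc n. count_list xs v)"
      by (rule sum.cong) (auto simp: c_def)
    also have "\<dots> = length (filter (\<lambda>x. x < Suc n) xs)"
      by (rule sum_count_list_less)
    also have "filter (\<lambda>x. x < Suc n) xs = xs"
      using xs by (intro filter_True) (auto simp: words_def less_Suc_eq_le)
    finally show ?case using xs by (simp add: T_def words_def)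
  next
    case (Suc m)
    have "c (Suc (m + Suc n)) = c (Suc m)"
      unfolding c_def by (metis add_Suc mod_add_self2)
    then show ?case using Suc by (simp add: T_def)
  qed
  have T_add: "T (r + k) = T r + (\<Sum>v<k. c (r + Suc v))" for r k
    by (induction k) (simp_all add: T_def)
  have good: "rotate_back n r xs \<in> PF n \<longleftrightarrow> (\<forall>k<Suc n. S r \<le> S (r + k))" if "r \<le> n" for r
  proof -
    have "(\<Sum>v<k. count_list (rotate_back n r xs) (Suc v)) = (\<Sum>v<k. c (r + Suc v))" if "k \<le> n" for k
      by (rule sum.cong) (use that \<open>r \<le> n\<close> xs in \<open>auto simp: count_rotate_back c_def\<close>)
    then have "rotate_back n r xs \<in> PF n \<longleftrightarrow> (\<forall>k\<le>n. k \<le> (\<Sum>v<k. c (r + Suc v)))"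
      by (auto simp: PF_iff_counts[OF rotate_in_words(1)[OF xs]])
    also have "\<dots> \<longleftrightarrow> (\<forall>k<Suc n. S r \<le> S (r + k))"
      by (simp add: S_def T_add less_Suc_eq_le del: of_nat_sum)
    finally show ?thesis .
  qed
  have "\<exists>!r. r < Suc n \<and> (\<forall>k<Suc n. S r \<le> S (r + k))"
  proof (rule cycle_lemma)
    show "S (m + Suc n) = S m - 1" for m
      unfolding S_def period by simp
  qed simp
  then show ?thesis
    using good by (metis less_Suc_eq_le)
qed

text \<open>
  Count pairs of a word satisfying \<open>E\<close> and a rotation that makes it park in two ways: each word
  has one such rotation, and each rotation identifies such words with the parking functions
  satisfying \<open>E\<close>.
\<close>

lemma card_PF_rotation_invariant:
  assumes inv: "\<And>xs r. xs \<in> words n \<Longrightarrow> r \<le> n \<Longrightarrow> E (rotate_back n r xs) \<longleftrightarrow> E xs"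
  shows "(n + 1) * card {\<alpha> \<in> PF n. E \<alpha>} = card {xs \<in> words n. E xs}"
proof -
  let ?W = "{xs \<in> words n. E xs}"
  let ?P = "{\<alpha> \<in> PF n. E \<alpha>}"
  have fibre: "card {xs \<in> ?W. rotate_back n r xs \<in> PF n} = card ?P" if "r \<le> n" for r
  proof (rule bij_betw_same_card)
    show "bij_betw (rotate_back n r) {xs \<in> ?W. rotate_back n r xs \<in> PF n} ?P"
    proof (rule bij_betwI[where g = "rotate_forth n r"])
      show "rotate_forth n r \<in> ?P \<rightarrow> {xs \<in> ?W. rotate_back n r xs \<in> PF n}"
      proof
        fix \<alpha> assume \<alpha>: "\<alpha> \<in> ?P"
        then have w: "\<alpha> \<in> words n" using PF_subset_words by blast
        then have w': "rotate_forth n r \<alpha> \<in> words n" by (rule rotate_in_words)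
        show "rotate_forth n r \<alpha> \<in> {xs \<in> ?W. rotate_back n r xs \<in> PF n}"
          using \<alpha> w w' rotate_inverse(2)[OF w that] inv[OF w' that] by simp
      qed
    qed (use that PF_subset_words in \<open>auto simp: rotate_inverse inv subset_iff\<close>)
  qed
  have one: "card {r \<in> {..n}. rotate_back n r xs \<in> PF n} = 1" if "xs \<in> ?W" for xs
    using unique_parking_rotation[of xs n] that by (auto simp: card_1_singleton_iff)
  have "(n + 1) * card ?P = (\<Sum>r\<le>n. card {xs \<in> ?W. rotate_back n r xs \<in> PF n})"
    using fibre by simp
  also have "\<dots> = (\<Sum>xs\<in>?W. card {r \<in> {..n}. rotate_back n r xs \<in> PF n})"
    by (rule sum_multicount_gen) (simp_all add: finite_words)
  also have "\<dots> = card ?W"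
    using one by simp
  finally show ?thesis .
qed

lemma card_PF: "(n + 1) * card (PF n) = (n + 1) ^ n"
  using card_PF_rotation_invariant[of n "\<lambda>_. True"] by (simp add: card_words)

section \<open>Parking functions with two equal entries\<close>

text \<open>
  Overwriting the entry at \<open>j\<close> by any of the \<open>n + 1\<close> letters produces every word once from the words
  with equal entries at \<open>i\<close> and \<open>j\<close>.
\<close>

lemma card_words_eq_entries:
  assumes "i < n" "j < n" "i \<noteq> j"
  shows "(n + 1) * card {xs \<in> words n. xs ! i = xs ! j} = (n + 1) ^ n"
proof -
  let ?E = "{xs \<in> words n. xs ! i = xs ! j}"
  have upd: "xs[j := a] \<in> words n" if "xs \<in> words n" "a \<le> n" for xs a
    using that set_update_subset_insert[of xs j a] by (auto simp: words_def)
  have nth_le: "xs ! k \<le> n" if "xs \<in> words n" "k < n" for xs k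
    using that by (auto simp: words_def dest: nth_mem)
  have len: "length xs = n" if "xs \<in> words n" for xs
    using that by (simp add: words_def)
  have "bij_betw (\<lambda>(xs, a). xs[j := a]) (?E \<times> {..n}) (words n)"
  proof (rule bij_betwI[where g = "\<lambda>ys. (ys[j := ys ! i], ys ! j)"])
    show "(\<lambda>ys. (ys[j := ys ! i], ys ! j)) \<in> words n \<rightarrow> ?E \<times> {..n}"
      using assms by (auto simp: upd nth_le len)
    show "(\<lambda>(xs, a). xs[j := a]) \<in> ?E \<times> {..n} \<rightarrow> words n"
      by (auto simp: upd)
    show "(\<lambda>ys. (ys[j := ys ! i], ys ! j)) ((\<lambda>(xs, a). xs[j := a]) p) = p" if "p \<in> ?E \<times> {..n}" for p
      using that assms by (auto simp: len)
    show "(\<lambda>(xs, a). xs[j := a]) ((\<lambda>ys. (ys[j := ys ! i], ys ! j)) ys) = ys" for ys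
      by simp
  qed
  then have "card (?E \<times> {..n}) = card (words n)"
    by (rule bij_betw_same_card)
  then show ?thesis
    by (simp add: card_cartesian_product card_words mult.commute)
qed

lemma card_PF_eq_entries:
  assumes "i < n" "j < n" "i \<noteq> j"
  shows "(n + 1)\<^sup>2 * card {\<alpha> \<in> PF n. \<alpha> ! i = \<alpha> ! j} = (n + 1) ^ n"
proof -
  have "rotate_back n r xs ! i = rotate_back n r xs ! j \<longleftrightarrow> xs ! i = xs ! j"
    if xs: "xs \<in> words n" and r: "r \<le> n" for xs r
  proof
    have len: "length xs = n" using xs by (simp add: words_def)
    {
      assume "xs ! i = xs ! j"
      then show "rotate_back n r xs ! i = rotate_back n r xs ! j"
        using assms len by (simp add: rotate_back_def)
    }
    assume "rotate_back n r xs ! i = rotate_back n r xs ! j"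
    then have "rotate_forth n r (rotate_back n r xs) ! i = rotate_forth n r (rotate_back n r xs) ! j"
      using assms len by (simp add: rotate_back_def rotate_forth_def)
    then show "xs ! i = xs ! j" using rotate_inverse(1)[OF xs r] by simp
  qed
  then have "(n + 1) * card {\<alpha> \<in> PF n. \<alpha> ! i = \<alpha> ! j} = card {xs \<in> words n. xs ! i = xs ! j}"
    by (rule card_PF_rotation_invariant)
  then show ?thesis
    using card_words_eq_entries[OF assms] by (simp only: power2_eq_square mult.assoc)
qed

section \<open>Inversions\<close>

lemma PF_mset_cong:
  assumes "mset xs = mset ys"
  shows "xs \<in> PF n \<longleftrightarrow> ys \<in> PF n"
proof -
  have "length (filter P xs) = length (filter P ys)" for P
    using assms by (metis mset_filter size_mset)
  then show ?thesis
    using mset_eq_setD[OF assms] mset_eq_length[OF assms] by (simp add: PF_def all_park_iff)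
qed

text \<open>Swapping the entries at \<open>i\<close> and \<open>j\<close> is an involution on \<open>PF n\<close> that exchanges the two sets.\<close>

lemma card_PF_descent_eq_ascent:
  assumes "i < n" "j < n"
  shows "card {\<alpha> \<in> PF n. \<alpha> ! j < \<alpha> ! i} = card {\<alpha> \<in> PF n. \<alpha> ! i < \<alpha> ! j}"
proof -
  define sw where "sw \<alpha> = \<alpha>[j := \<alpha> ! i, i := \<alpha> ! j]" for \<alpha> :: "nat list"
  have len: "length \<alpha> = n" if "\<alpha> \<in> PF n" for \<alpha>
    using that by (simp add: PF_def)
  have sw_PF: "sw \<alpha> \<in> PF n" if "\<alpha> \<in> PF n" for \<alpha>
    using PF_mset_cong[of "sw \<alpha>" \<alpha> n] that assms by (simp add: sw_def mset_swap len)
  have sw_sw: "sw (sw \<alpha>) = \<alpha>" if "\<alpha> \<in> PF n" for \<alpha>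
    using assms len[OF that] by (auto simp: sw_def nth_list_update intro!: nth_equalityI)
  have "bij_betw sw {\<alpha> \<in> PF n. \<alpha> ! j < \<alpha> ! i} {\<alpha> \<in> PF n. \<alpha> ! i < \<alpha> ! j}"
    by (rule bij_betwI[where g = sw])
      (use assms in \<open>auto simp: sw_PF sw_sw, auto simp: sw_def len nth_list_update\<close>)
  then show ?thesis by (rule bij_betw_same_card)
qed

text \<open>Cleared of denominators, so that the counts stay natural numbers without division.\<close>

lemma card_PF_descent:
  assumes "i < n" "j < n" "i \<noteq> j"
  shows "2 * (n + 1)\<^sup>2 * card {\<alpha> \<in> PF n. \<alpha> ! j < \<alpha> ! i} = n * (n + 1) ^ n"
proof -
  let ?D = "{\<alpha> \<in> PF n. \<alpha> ! j < \<alpha> ! i}" and ?A = "{\<alpha> \<in> PF n. \<alpha> ! i < \<alpha> ! j}"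
    and ?E = "{\<alpha> \<in> PF n. \<alpha> ! i = \<alpha> ! j}"
  have "PF n = ?D \<union> (?A \<union> ?E)" by auto
  then have "card (PF n) = card (?D \<union> (?A \<union> ?E))" by simp
  also have "\<dots> = card ?D + (card ?A + card ?E)"
    by (subst card_Un_disjoint, auto simp: finite_PF, subst card_Un_disjoint, auto simp: finite_PF)
  finally have "card (PF n) = 2 * card ?D + card ?E"
    using card_PF_descent_eq_ascent[OF assms(1,2)] by simp
  then have "(n + 1)\<^sup>2 * card (PF n) = 2 * (n + 1)\<^sup>2 * card ?D + (n + 1) ^ n"
    using card_PF_eq_entries[OF assms] by (simp add: algebra_simps)
  moreover have "(n + 1)\<^sup>2 * card (PF n) = (n + 1) * (n + 1) ^ n"
    using card_PF[of n] by (simp only: power2_eq_square mult.assoc)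
  ultimately show ?thesis by (simp add: algebra_simps)
qed

lemma sum_inversions_PF:
  "(\<Sum>\<alpha>\<in>PF n. inversions \<alpha>) =
    (\<Sum>(j, i)\<in>Sigma {..<n} lessThan. card {\<alpha> \<in> PF n. \<alpha> ! j < \<alpha> ! i})"
proof -
  let ?P = "Sigma {..<n} lessThan"
  have "inversions \<alpha> = card {p \<in> ?P. \<alpha> ! fst p < \<alpha> ! snd p}" if "\<alpha> \<in> PF n" for \<alpha>
    unfolding inversions_def
    by (rule bij_betw_same_card[of prod.swap], rule bij_betwI[where g = prod.swap])
      (use that in \<open>auto simp: PF_def\<close>)
  then have "(\<Sum>\<alpha>\<in>PF n. inversions \<alpha>) = (\<Sum>\<alpha>\<in>PF n. card {p \<in> ?P. \<alpha> ! fst p < \<alpha> ! snd p})"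
    by simp
  also have "\<dots> = (\<Sum>p\<in>?P. card {\<alpha> \<in> PF n. \<alpha> ! fst p < \<alpha> ! snd p})"
    by (rule sum_multicount_gen) (simp_all add: finite_PF)
  finally show ?thesis by (simp add: case_prod_beta)
qed

theorem corollary5p4:
  fixes n :: nat
  assumes "n \<ge> 1"
  shows "(\<Sum>\<alpha>\<in>PF n. real (inversions \<alpha>)) =
    real n * (real n + 1) powi (int n - 2) / 2 * real (n choose 2)"
proof -
  let ?P = "Sigma {..<n} lessThan"
  let ?q = "real n * (real n + 1) powi (int n - 2) / 2"
  have descent: "real (card {\<alpha> \<in> PF n. \<alpha> ! j < \<alpha> ! i}) = ?q" if "(j, i) \<in> ?P" for j i
  proof -
    have "2 * (n + 1)\<^sup>2 * card {\<alpha> \<in> PF n. \<alpha> ! j < \<alpha> ! i} = n * (n + 1) ^ n"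
      by (rule card_PF_descent) (use that in auto)
    then have "real (2 * (n + 1)\<^sup>2 * card {\<alpha> \<in> PF n. \<alpha> ! j < \<alpha> ! i}) = real (n * (n + 1) ^ n)"
      by (rule arg_cong)
    then have "2 * (real n + 1)\<^sup>2 * real (card {\<alpha> \<in> PF n. \<alpha> ! j < \<alpha> ! i}) = real n * (real n + 1) ^ n"
      by (simp add: add.commute)
    moreover have "(real n + 1) ^ n = (real n + 1)\<^sup>2 * (real n + 1) powi (int n - 2)"
      by (simp add: power_int_diff)
    ultimately have "(real n + 1)\<^sup>2 * real (card {\<alpha> \<in> PF n. \<alpha> ! j < \<alpha> ! i}) = (real n + 1)\<^sup>2 * ?q"
      by simp
    then show ?thesis
      by (subst (asm) mult_left_cancel) simp_all
  qed
  have "card ?P = (\<Sum>j<n. j)"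
    by (simp add: card_SigmaI)
  also have "\<dots> = n choose 2"
    by (induction n) (simp_all add: numeral_2_eq_2)
  finally have card_P: "card ?P = n choose 2" .
  have "(\<Sum>\<alpha>\<in>PF n. real (inversions \<alpha>)) = real (\<Sum>\<alpha>\<in>PF n. inversions \<alpha>)"
    by simp
  also have "\<dots> = (\<Sum>(j, i)\<in>?P. real (card {\<alpha> \<in> PF n. \<alpha> ! j < \<alpha> ! i}))"
    by (simp add: sum_inversions_PF case_prod_beta)
  also have "\<dots> = (\<Sum>p\<in>?P. ?q)"
    by (rule sum.cong) (auto simp: descent)
  also have "\<dots> = ?q * real (n choose 2)"
    by (simp add: card_P)
  finally show ?thesis .
qed

end
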